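(* Let $a,b$ be positive square-free integers with $\gcd(a,b) \leq 2$, and let $f(x_0,y_1,y_2,y_3) = x_0^2 - a y_1^2 - b y_2^2 - ab y_3^2$. Let $d \in \mathbb{Z}$ be square-free. Then for every odd prime $p$ dividing $ab$, $f$ properly represents $d \bmod p^2$, i.e., there exist integers $r_0,r_1,r_2,r_3$ with $\gcd(r_0,r_1,r_2,r_3) = 1$ and $f(r_0,r_1,r_2,r_3) \equiv d \pmod{p^2}$. *)

theory Defs
  imports "HOL-Computational_Algebra.Squarefree" "HOL-Number_Theory.Cong"
begin

definition quat_form :: "int \<Rightarrow> int \<Rightarrow> int \<Rightarrow> int \<Rightarrow> int \<Rightarrow> int \<Rightarrow> int" where
  "quat_form a b x\<^sub>0 y\<^sub>1 y\<^sub>2 y\<^sub>3 = x\<^sub>0^2 - a * y\<^sub>1^2 - b * y\<^sub>2^2 - a * b * y\<^sub>3^2"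

definition properly_represents_mod ::
    "(int \<Rightarrow> int \<Rightarrow> int \<Rightarrow> int \<Rightarrow> int) \<Rightarrow> int \<Rightarrow> int \<Rightarrow> bool" where
  "properly_represents_mod f d m \<longleftrightarrow>
     (\<exists>r\<^sub>0 r\<^sub>1 r\<^sub>2 r\<^sub>3. Gcd {r\<^sub>0, r\<^sub>1, r\<^sub>2, r\<^sub>3} = 1 \<and> [f r\<^sub>0 r\<^sub>1 r\<^sub>2 r\<^sub>3 = d] (mod m))"

end

theory Submission imports Defs begin

text \<open>
  Since \<open>gcd a b \<le> 2\<close>, the odd prime \<open>p\<close> divides exactly one of \<open>a\<close>, \<open>b\<close>, say \<open>a = p a'\<close>.
  A binary form \<open>u x\<^sup>2 + v y\<^sup>2\<close> with unit coefficients represents every residue modulo \<open>p\<close>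
  by the pigeonhole principle.  If \<open>p\<close> does not divide \<open>d\<close>, solve \<open>x\<^sup>2 - b y\<^sup>2 = d + a\<close> modulo \<open>p\<close>
  and lift by Hensel; then \<open>(x, 1, y, 0)\<close> is a proper representation.  If \<open>d = p d'\<close>, solve
  \<open>a' x\<^sup>2 + a' b y\<^sup>2 = -d'\<close> modulo \<open>p\<close>; since \<open>d\<close> is square-free, \<open>x\<close> and \<open>y\<close> are not both
  divisible by \<open>p\<close>, and \<open>(p, x, 0, y)\<close> is a proper representation.
\<close>

text \<open>A collision makes \<open>p\<close> divide \<open>(x - y) * (x + y)\<close>. On this half
  range both factors are below \<open>p\<close> in absolute value, so one of them is 0, and either
  case forces \<open>x = y\<close>.\<close>

lemma inj_on_square_mod_prime:
  fixes p u c :: int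
  assumes p: "prime p" and u: "\<not> p dvd u"
  shows "inj_on (\<lambda>x. (u * x\<^sup>2 + c) mod p) {0..(p - 1) div 2}"
proof (rule inj_onI)
  fix x y
  assume x: "x \<in> {0..(p - 1) div 2}" and y: "y \<in> {0..(p - 1) div 2}"
    and eq: "(u * x\<^sup>2 + c) mod p = (u * y\<^sup>2 + c) mod p"
  have "p dvd (u * x\<^sup>2 + c) - (u * y\<^sup>2 + c)"
    using eq by (simp add: mod_eq_dvd_iff)
  also have "(u * x\<^sup>2 + c) - (u * y\<^sup>2 + c) = u * ((x - y) * (x + y))"
    by (simp add: algebra_simps power2_eq_square)
  finally have "p dvd x - y \<or> p dvd x + y"
    using p u by (simp add: prime_dvd_mult_iff)
  moreover have "\<bar>x - y\<bar> < p" "0 \<le> x + y" "x + y < p"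
    using x y prime_gt_1_int[OF p] by auto
  ultimately have "x - y = 0 \<or> x + y = 0"
    using zdvd_not_zless[of "x + y" p] dvd_imp_le_int[of "x - y" p] prime_gt_1_int[OF p] by force
  thus "x = y" using x y by auto
qed

lemma binary_form_represents_mod_prime:
  fixes p u v c :: int
  assumes p: "prime p" "odd p" and u: "\<not> p dvd u" and v: "\<not> p dvd v"
  obtains x y where "[u * x\<^sup>2 + v * y\<^sup>2 = c] (mod p)"
proof -
  define S where "S = {0..(p - 1) div 2}"
  \<comment> \<open>The summand \<open>0\<close> gives \<open>A\<close> the same shape as
    \<open>B\<close>, so one injectivity lemma counts both.\<close>
  define A where "A = (\<lambda>x. (u * x\<^sup>2 + 0) mod p) ` S"
  define B where "B = (\<lambda>y. (- v * y\<^sup>2 + c) mod p) ` S"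
  have p1: "p > 1" using p by (simp add: prime_gt_1_int)
  have "card A = card S" "card B = card S"
    using inj_on_square_mod_prime[OF p(1) u, of 0] inj_on_square_mod_prime[OF p(1), of "- v" c] v
    by (simp_all add: A_def B_def S_def card_image)
  \<comment> \<open>As \<open>p\<close> is odd, \<open>A\<close> and \<open>B\<close> have
    \<open>(p + 1) / 2\<close> elements each; if disjoint, they would fill \<open>p + 1\<close> of
    only \<open>p\<close> residues.\<close>
  moreover have "2 * card S = nat (p + 1)"
    using p p1 by (auto simp: S_def elim!: oddE)
  moreover have sub: "A \<union> B \<subseteq> {0..<p}"
    using p1 by (auto simp: A_def B_def)
  moreover have "card (A \<union> B) \<le> nat p"
    using card_mono[OF _ sub] by simp
  moreover have "finite A" "finite B"
    by (simp_all add: A_def B_def S_def)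
  ultimately have "A \<inter> B \<noteq> {}"
    using p1 card_Un_disjoint[of A B] by auto
  then obtain x y where "(u * x\<^sup>2) mod p = (- v * y\<^sup>2 + c) mod p"
    by (auto simp: A_def B_def)
  hence "[u * x\<^sup>2 + v * y\<^sup>2 = c] (mod p)"
    by (simp add: cong_iff_dvd_diff mod_eq_dvd_iff algebra_simps)
  thus ?thesis by (rule that)
qed

text \<open>One Newton step in \<open>x\<close>, with \<open>w\<close> held fixed: the derivative
  \<open>2 * u * x\<close> is a unit modulo \<open>p\<close>.\<close>

lemma square_lift_mod_prime_square:
  fixes p u x w c :: int
  assumes p: "prime p" "odd p" and u: "\<not> p dvd u" and x: "\<not> p dvd x"
    and eq: "[u * x\<^sup>2 + w = c] (mod p)"
  obtains x' where "[u * x'\<^sup>2 + w = c] (mod p\<^sup>2)"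
proof -
  obtain k where k: "u * x\<^sup>2 + w - c = p * k"
    using eq by (auto simp: cong_iff_dvd_diff)
  have "\<not> p dvd 2"
    using p prime_gt_1_int[OF p(1)] zdvd_imp_le[of p 2] by (cases "p = 2") auto
  hence "coprime (2 * u * x) p"
    using p u x by (metis coprime_commute prime_dvd_mult_iff prime_imp_coprime)
  then obtain s where s: "[2 * u * x * s = 1] (mod p)"
    using cong_solve_coprime_int by blast
  have "[2 * u * x * s * (- k) = 1 * (- k)] (mod p)"
    using s by (rule cong_scalar_right)
  hence "p dvd 2 * u * x * (- (s * k)) + k"
    by (simp add: cong_iff_dvd_diff algebra_simps)
  then obtain m where m: "2 * u * x * (- (s * k)) + k = p * m" ..
  \<comment> \<open>With \<open>s\<close> inverse to the derivative and \<open>p * k\<close> the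
    defect at \<open>x\<close>, the shift by \<open>- p * s * k\<close> cancels the defect modulo
    \<open>p\<^sup>2\<close>.\<close>
  have "u * (x + p * (- (s * k)))\<^sup>2 + w - c
      = (u * x\<^sup>2 + w - c) + p * (2 * u * x * (- (s * k))) + p\<^sup>2 * (u * (s * k)\<^sup>2)"
    by (simp add: algebra_simps power2_eq_square)
  also have "\<dots> = p * (2 * u * x * (- (s * k)) + k) + p\<^sup>2 * (u * (s * k)\<^sup>2)"
    unfolding k by (simp add: algebra_simps)
  also have "\<dots> = p\<^sup>2 * (m + u * (s * k)\<^sup>2)"
    unfolding m by (simp add: algebra_simps power2_eq_square)
  finally have "[u * (x + p * (- (s * k)))\<^sup>2 + w = c] (mod p\<^sup>2)"
    by (simp add: cong_iff_dvd_diff)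
  thus ?thesis by (rule that)
qed

text \<open>Since \<open>c\<close> is a unit, a solution modulo \<open>p\<close> has a coordinate
  prime to \<open>p\<close>; that coordinate is lifted and the other kept.\<close>

lemma binary_form_represents_unit_mod_prime_square:
  fixes p u v c :: int
  assumes p: "prime p" "odd p" and u: "\<not> p dvd u" and v: "\<not> p dvd v" and c: "\<not> p dvd c"
  obtains x y where "[u * x\<^sup>2 + v * y\<^sup>2 = c] (mod p\<^sup>2)"
proof -
  obtain x y where xy: "[u * x\<^sup>2 + v * y\<^sup>2 = c] (mod p)"
    using binary_form_represents_mod_prime[OF p u v] .
  have "\<not> p dvd u * x\<^sup>2 + v * y\<^sup>2"
    using xy c cong_dvd_iff by blast
  hence "\<not> p dvd x \<or> \<not> p dvd y"
    by (auto simp: power2_eq_square)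
  thus ?thesis
  proof
    assume "\<not> p dvd x"
    from square_lift_mod_prime_square[OF p u this xy] show ?thesis
      using that by blast
  next
    assume y: "\<not> p dvd y"
    have "[v * y\<^sup>2 + u * x\<^sup>2 = c] (mod p)"
      using xy by (simp add: add.commute)
    from square_lift_mod_prime_square[OF p v y this] show ?thesis
      using that by (metis add.commute)
  qed
qed

lemma quat_form_properly_represents_mod_prime_square:
  fixes a b d p :: int
  assumes p: "prime p" "odd p" and pa: "p dvd a" and pb: "\<not> p dvd b"
    and a: "\<not> p\<^sup>2 dvd a" and d: "\<not> p\<^sup>2 dvd d"
  shows "properly_represents_mod (quat_form a b) d (p\<^sup>2)"
proof (cases "p dvd d")
  case False
  hence "\<not> p dvd d + a"
    using pa by (simp add: dvd_add_left_iff)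
  moreover have "\<not> p dvd 1" "\<not> p dvd - b"
    using p pb not_prime_unit by auto
  \<comment> \<open>The target \<open>d + a\<close> compensates for the coordinate 1 at
    \<open>a\<close>, which makes the gcd trivial.\<close>
  ultimately obtain x y where "[1 * x\<^sup>2 + (- b) * y\<^sup>2 = d + a] (mod p\<^sup>2)"
    using binary_form_represents_unit_mod_prime_square[OF p] by metis
  hence "[quat_form a b x 1 y 0 = d] (mod p\<^sup>2)"
    by (simp add: quat_form_def cong_iff_dvd_diff algebra_simps)
  moreover have "Gcd {x, 1, y, 0} = 1" by simp
  ultimately show ?thesis
    unfolding properly_represents_mod_def by blast
next
  case True
  then obtain d' where d': "d = p * d'" by blast
  obtain a' where a': "a = p * a'" using pa by blast
  have nd: "\<not> p dvd d'" and na: "\<not> p dvd a'"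
    using a d by (auto simp: a' d' power2_eq_square)
  \<comment> \<open>With first coordinate \<open>p\<close> and third 0, all other terms of the form
    and \<open>d\<close> carry a factor \<open>p\<close>. Dividing it out leaves a condition modulo
    \<open>p\<close> only, so no lifting is required.\<close>
  obtain x y where xy: "[a' * x\<^sup>2 + a' * b * y\<^sup>2 = - d'] (mod p)"
    using binary_form_represents_mod_prime[OF p na, of "a' * b" "- d'"] na pb p
    by (auto simp: prime_dvd_mult_iff)
  have "\<not> p dvd a' * x\<^sup>2 + a' * b * y\<^sup>2"
    using xy nd cong_dvd_iff by (metis dvd_minus_iff)
  hence "\<not> p dvd x \<or> \<not> p dvd y"
    by (auto simp: power2_eq_square)
  hence "coprime p (gcd x y)"
    using p by (intro prime_imp_coprime) auto
  hence "Gcd {p, x, 0, y} = 1"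
    by (simp add: coprime_iff_gcd_eq_1)
  moreover have "[quat_form a b p x 0 y = d] (mod p\<^sup>2)"
  proof -
    obtain k where k: "a' * x\<^sup>2 + a' * b * y\<^sup>2 + d' = p * k"
      using xy by (auto simp: cong_iff_dvd_diff)
    have "quat_form a b p x 0 y - d = p\<^sup>2 - p * (a' * x\<^sup>2 + a' * b * y\<^sup>2 + d')"
      by (simp add: quat_form_def a' d' algebra_simps)
    also have "\<dots> = p\<^sup>2 * (1 - k)"
      unfolding k by (simp add: algebra_simps power2_eq_square)
    finally show ?thesis
      by (simp add: cong_iff_dvd_diff)
  qed
  ultimately show ?thesis
    unfolding properly_represents_mod_def by blast
qed

lemma quat_form_swap: "quat_form a b x y z w = quat_form b a x z y w"
  by (simp add: quat_form_def algebra_simps)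

text \<open>Reduces the case where \<open>p\<close> divides \<open>b\<close> to the case where it
  divides \<open>a\<close>.\<close>

lemma properly_represents_mod_quat_form_swap:
  assumes "properly_represents_mod (quat_form a b) d m"
  shows "properly_represents_mod (quat_form b a) d m"
proof -
  obtain x y z w where "Gcd {x, y, z, w} = 1" "[quat_form a b x y z w = d] (mod m)"
    using assms unfolding properly_represents_mod_def by blast
  hence "Gcd {x, z, y, w} = 1" "[quat_form b a x z y w = d] (mod m)"
    by (simp_all add: quat_form_swap[of b a] insert_commute)
  thus ?thesis
    unfolding properly_represents_mod_def by blast
qed

theorem theorem3p2:
  fixes a b d :: int
  assumes "a > 0" and "b > 0"
    and "squarefree a" and "squarefree b"
    and "gcd a b \<le> 2"
    and "squarefree d"
  shows "\<forall>p::int. prime p \<and> odd p \<and> p dvd a * b \<longrightarrow>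
           properly_represents_mod (quat_form a b) d (p^2)"
proof (intro allI impI)
  fix p :: int
  assume "prime p \<and> odd p \<and> p dvd a * b"
  hence p: "prime p" "odd p" and dvd: "p dvd a \<or> p dvd b"
    by (auto simp: prime_dvd_mult_iff)
  have not_both: "\<not> (p dvd a \<and> p dvd b)"
  proof
    assume "p dvd a \<and> p dvd b"
    hence "p \<le> gcd a b"
      using \<open>a > 0\<close> by (intro zdvd_imp_le) auto
    thus False
      using p \<open>gcd a b \<le> 2\<close> prime_gt_1_int[of p] by (cases "p = 2") auto
  qed
  have sq: "\<not> p\<^sup>2 dvd n" if "squarefree n" for n
    using squarefreeD[OF that, of p] p by auto
  note main = quat_form_properly_represents_mod_prime_square[OF p]
  show "properly_represents_mod (quat_form a b) d (p^2)"
    using dvd not_both main[of a b d] main[of b a d] sq assms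
      properly_represents_mod_quat_form_swap by blast
qed

end
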